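(* Let $q$ be a prime power and let $\Delta=([\ell],\mathcal{F})$ be a simplicial complex on vertex set $[\ell]$. For a simplicial complex $\Delta'$ on a vertex set $V$, let $\mathcal{S}_{\Delta'}^q$ denote the arrangement in $\mathbb{F}_q^{V}$ (coordinates $x_v$, $v\in V$) $$\mathcal{S}_{\Delta'}^q=\bigcup_{\{i_1,\dots,i_r\}\text{ a nonempty face of }\Delta'}\{\ker(a_{i_1}x_{i_1}+\dots+a_{i_r}x_{i_r})\mid a_{i_j}\in\mathbb{F}_q^\times\text{ for all } j\}.$$ Suppose $e=\{i_1,i_2\}$ is an edge of the underlying graph of $\Delta$ (i.e. a $2$-element face) and that $e$ is a maximal face of $\Delta$. Let $\Delta\setminus e$ be the simplicial complex on $[\ell]$ obtained by removing the face $e$, and let $\Delta/e$ be the simplicial complex on the $(\ell-1)$-element vertex set obtained from $[\ell]$ by identifying $i_1$ and $i_2$, whose faces are the images of the faces of $\Delta$ under this identification. Then $$\chi(\mathcal{S}_\Delta^q,t)=\chi(\mathcal{S}_{\Delta\setminus e}^q,t)-(q-1)\,\chi(\mathcal{S}_{\Delta/e}^q,t).$$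
   Context: A simplicial complex $(V,\mathcal{F})$ has face set $\mathcal{F}\subseteq 2^V$ closed under subsets, every vertex being a face. Its underlying graph has the $2$-element faces as edges. For a central arrangement $\mathcal{A}$ in $\mathbb{K}^n$, $\chi(\mathcal{A},t)=\sum_{\mathcal{B}\subseteq\mathcal{A}}(-1)^{|\mathcal{B}|}t^{\dim\bigcap_{H\in\mathcal{B}}H}$, with the empty intersection equal to $\mathbb{K}^n$. *)

theory Defs
  imports
    "HOL-Library.Function_Algebras"
    "HOL-Library.Cardinality"
    "HOL-Computational_Algebra.Polynomial"
    "HOL-Number_Theory.Prime_Powers"
begin

section \<open>Simplicial complexes\<close>

definition simplicial_complex :: "'v set \<Rightarrow> 'v set set \<Rightarrow> bool" where
  "simplicial_complex V F \<longleftrightarrow>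
     F \<subseteq> Pow V \<and> (\<forall>f\<in>F. \<forall>g. g \<subseteq> f \<longrightarrow> g \<in> F) \<and> (\<forall>v\<in>V. {v} \<in> F)"

definition underlying_edges :: "'v set set \<Rightarrow> 'v set set" where
  "underlying_edges F = {e \<in> F. card e = 2}"

definition maximal_face :: "'v set set \<Rightarrow> 'v set \<Rightarrow> bool" where
  "maximal_face F e \<longleftrightarrow> e \<in> F \<and> (\<forall>f\<in>F. e \<subseteq> f \<longrightarrow> f = e)"

definition delete_face :: "'v set set \<Rightarrow> 'v set \<Rightarrow> 'v set set" where
  "delete_face F e = F - {e}"

text \<open>The vertex set obtained from \<open>V\<close> by identifying \<open>i1\<close> and \<open>i2\<close> is modelled as
  \<open>identify i1 i2 ` V\<close>, where \<open>i1\<close> represents the merged vertex.\<close>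

definition identify :: "'v \<Rightarrow> 'v \<Rightarrow> 'v \<Rightarrow> 'v" where
  "identify i1 i2 v = (if v = i2 then i1 else v)"

definition contract_faces :: "'v \<Rightarrow> 'v \<Rightarrow> 'v set set \<Rightarrow> 'v set set" where
  "contract_faces i1 i2 F = (\<lambda>f. identify i1 i2 ` f) ` F"

lemma simplicial_complex_delete_face:
  assumes "simplicial_complex V F" "maximal_face F e" "e \<in> underlying_edges F"
  shows "simplicial_complex V (delete_face F e)"
proof -
  have "card e = 2" using assms(3) by (simp add: underlying_edges_def)
  then have ne: "e \<noteq> {v}" for v by auto
  show ?thesis
    unfolding simplicial_complex_def
  proof (intro conjI ballI allI impI)
    show "delete_face F e \<subseteq> Pow V"
      using assms(1) by (auto simp: simplicial_complex_def delete_face_def)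
  next
    fix f g assume f: "f \<in> delete_face F e" and g: "g \<subseteq> f"
    have "f \<in> F" "f \<noteq> e" using f by (auto simp: delete_face_def)
    moreover have "g \<in> F"
      using assms(1) g \<open>f \<in> F\<close> by (simp add: simplicial_complex_def)
    moreover have "g \<noteq> e"
      using assms(2) g \<open>f \<in> F\<close> \<open>f \<noteq> e\<close> by (auto simp: maximal_face_def)
    ultimately show "g \<in> delete_face F e" by (simp add: delete_face_def)
  next
    fix v assume "v \<in> V"
    then show "{v} \<in> delete_face F e"
      using assms(1) ne[of v] by (auto simp: simplicial_complex_def delete_face_def)
  qed
qed

lemma simplicial_complex_contract_faces:
  assumes "simplicial_complex V F"
  shows "simplicial_complex (identify i1 i2 ` V) (contract_faces i1 i2 F)"
  unfolding simplicial_complex_def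
proof (intro conjI ballI allI impI)
  show "contract_faces i1 i2 F \<subseteq> Pow (identify i1 i2 ` V)"
    using assms unfolding simplicial_complex_def contract_faces_def by blast
next
  fix f g assume "f \<in> contract_faces i1 i2 F" "g \<subseteq> f"
  then obtain h where h: "h \<in> F" "g \<subseteq> identify i1 i2 ` h"
    unfolding contract_faces_def by blast
  then obtain k where k: "k \<subseteq> h" "g = identify i1 i2 ` k"
    by (meson subset_imageE)
  then have "k \<in> F" using assms h(1) by (simp add: simplicial_complex_def)
  then show "g \<in> contract_faces i1 i2 F"
    unfolding contract_faces_def k(2) by (rule imageI)
next
  fix v assume "v \<in> identify i1 i2 ` V"
  then obtain w where "w \<in> V" "v = identify i1 i2 w" by blast
  then have "{w} \<in> F" "{v} = identify i1 i2 ` {w}"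
    using assms by (auto simp: simplicial_complex_def)
  then show "{v} \<in> contract_faces i1 i2 F"
    unfolding contract_faces_def by blast
qed

lemma card_identify:
  assumes "finite V" "i1 \<in> V" "i2 \<in> V" "i1 \<noteq> i2"
  shows "card (identify i1 i2 ` V) = card V - 1"
proof -
  have "identify i1 i2 ` V = V - {i2}"
    using assms by (auto simp: identify_def)
  then show ?thesis using assms by simp
qed

section \<open>Arrangements in a coordinate space\<close>

text \<open>The coordinate space indexed by \<open>V\<close> is modelled by the functions vanishing outside \<open>V\<close>,
  so that dimensions can be taken in the vector space of all functions.\<close>

definition coord_space :: "'v set \<Rightarrow> ('v \<Rightarrow> 'k::field) set" where
  "coord_space V = {x. \<forall>v. v \<notin> V \<longrightarrow> x v = 0}"

definition fun_scale :: "'k::field \<Rightarrow> ('v \<Rightarrow> 'k) \<Rightarrow> 'v \<Rightarrow> 'k" where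
  "fun_scale c x = (\<lambda>v. c * x v)"

lemma vector_space_fun_scale: "vector_space (fun_scale :: 'k::field \<Rightarrow> ('v \<Rightarrow> 'k) \<Rightarrow> 'v \<Rightarrow> 'k)"
  by unfold_locales (auto simp: fun_scale_def fun_eq_iff algebra_simps)

abbreviation fun_dim :: "('v \<Rightarrow> 'k::field) set \<Rightarrow> nat" where
  "fun_dim \<equiv> vector_space.dim fun_scale"

text \<open>Intersecting with \<open>coord_space V\<close> makes the empty intersection the whole space.\<close>

definition arr_char_poly :: "'v set \<Rightarrow> ('v \<Rightarrow> 'k::field) set set \<Rightarrow> int poly" where
  "arr_char_poly V A =
     (\<Sum>B\<in>Pow A. monom ((-1) ^ card B) (fun_dim (coord_space V \<inter> \<Inter>B)))"

definition lin_kernel :: "'v set \<Rightarrow> 'v set \<Rightarrow> ('v \<Rightarrow> 'k::field) \<Rightarrow> ('v \<Rightarrow> 'k) set" where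
  "lin_kernel V f a = {x \<in> coord_space V. (\<Sum>i\<in>f. a i * x i) = 0}"

definition complex_arrangement :: "'v set \<Rightarrow> 'v set set \<Rightarrow> ('v \<Rightarrow> 'k::field) set set" where
  "complex_arrangement V F =
     (\<Union>f\<in>F - {{}}. {lin_kernel V f a |a. \<forall>i\<in>f. a i \<noteq> 0})"

text \<open>The type argument selects the coefficient field.\<close>

definition complex_char_poly :: "'k::field itself \<Rightarrow> 'v set \<Rightarrow> 'v set set \<Rightarrow> int poly" where
  "complex_char_poly K V F =
     arr_char_poly V (complex_arrangement V F :: ('v \<Rightarrow> 'k) set set)"

end

theory Submission
  imports Defs "HOL-Library.FuncSet"
begin

text \<open>
  For an arrangement over a field with \<open>q\<close> elements, inclusion-exclusion shows that
  \<open>\<chi>(A, q ^ m)\<close> counts the \<open>m\<close>-tuples of points that are not contained in any single hyperplane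
  of \<open>A\<close>. For the complex with \<open>e = {i1, i2}\<close> removed, such a tuple either is also counted for the
  whole complex, or satisfies \<open>x i2 = c * x i1\<close> throughout for some \<open>c \<noteq> 0\<close>. This \<open>c\<close> is unique
  because the tuple avoids the hyperplane \<open>x i1 = 0\<close>, and the tuples belonging to a fixed \<open>c\<close>
  correspond to those counted for the contraction: as \<open>e\<close> is maximal, no other face contains both
  \<open>i1\<close> and \<open>i2\<close>. So the two sides agree at all powers of \<open>q\<close>.
\<close>

section \<open>Characteristic polynomials and counting\<close>

interpretation fun_vs: vector_space "fun_scale :: 'k::field \<Rightarrow> ('v \<Rightarrow> 'k) \<Rightarrow> 'v \<Rightarrow> 'k"
  by (rule vector_space_fun_scale)

text \<open>Since \<open>b\<close> lies outside \<open>span B\<close>, the map (c, y) to c b + y is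
  a bijection from scalars times \<open>span B\<close> onto \<open>span (insert b B)\<close>, so
  each basis vector multiplies the size by the order of the field.\<close>

lemma card_span_independent:
  fixes B :: "('v \<Rightarrow> 'k::{field,finite}) set"
  assumes "finite B" "fun_vs.independent B"
  shows "finite (fun_vs.span B) \<and> card (fun_vs.span B) = CARD('k) ^ card B"
  using assms
proof (induction B rule: finite_induct)
  case empty
  then show ?case by simp
next
  case (insert b B)
  have b: "b \<notin> fun_vs.span B" and ind: "fun_vs.independent B"
    using insert.prems insert.hyps by (auto simp: fun_vs.independent_insert)
  let ?h = "\<lambda>(c, y). fun_scale c b + y"
  have "inj_on ?h (UNIV \<times> fun_vs.span B)"
  proof (rule inj_onI, clarify)
    fix c y c' y'
    assume y: "y \<in> fun_vs.span B" "y' \<in> fun_vs.span B"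
      and eq: "fun_scale c b + y = fun_scale c' b + y'"
    have "fun_scale (c - c') b = y' - y"
      using eq by (simp add: fun_vs.scale_left_diff_distrib algebra_simps)
    then have sp: "fun_scale (c - c') b \<in> fun_vs.span B"
      using y by (simp add: fun_vs.span_diff)
    have "c = c'"
    proof (rule ccontr)
      assume "c \<noteq> c'"
      then have "fun_scale (inverse (c - c')) (fun_scale (c - c') b) = b"
        by simp
      then show False using fun_vs.span_scale[OF sp, of "inverse (c - c')"] b by simp
    qed
    then show "c = c' \<and> y = y'" using eq by simp
  qed
  moreover have "fun_vs.span (insert b B) = ?h ` (UNIV \<times> fun_vs.span B)"
  proof (intro equalityI subsetI)
    fix x assume "x \<in> fun_vs.span (insert b B)"
    then obtain c where "x - fun_scale c b \<in> fun_vs.span B"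
      by (auto simp: fun_vs.span_insert)
    then show "x \<in> ?h ` (UNIV \<times> fun_vs.span B)"
      by (intro image_eqI[of _ _ "(c, x - fun_scale c b)"]) auto
  next
    fix x assume "x \<in> ?h ` (UNIV \<times> fun_vs.span B)"
    then obtain c y where "y \<in> fun_vs.span B" "x = fun_scale c b + y" by auto
    then have "x - fun_scale c b \<in> fun_vs.span B" by simp
    then show "x \<in> fun_vs.span (insert b B)"
      unfolding fun_vs.span_insert by blast
  qed
  ultimately show ?case
    using insert ind by (simp add: card_image card_cartesian_product)
qed

lemma card_subspace:
  fixes W :: "('v \<Rightarrow> 'k::{field,finite}) set"
  assumes "fun_vs.subspace W" "finite W"
  shows "card W = CARD('k) ^ fun_dim W"
proof -
  obtain B where B: "B \<subseteq> W" "fun_vs.independent B" "W \<subseteq> fun_vs.span B" "card B = fun_dim W"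
    using fun_vs.basis_exists by blast
  have "fun_vs.span B = W"
    using B assms(1) by (simp add: fun_vs.span_minimal equalityI)
  then show ?thesis
    using card_span_independent[of B] B assms(2) finite_subset by metis
qed

lemma finite_coord_space:
  assumes "finite V"
  shows "finite (coord_space V :: ('v \<Rightarrow> 'k::{field,finite}) set)"
proof -
  have "coord_space V \<subseteq> {x::'v \<Rightarrow> 'k. \<forall>i. (i \<in> V \<longrightarrow> x i \<in> UNIV) \<and> (i \<notin> V \<longrightarrow> x i = 0)}"
    by (auto simp: coord_space_def)
  then show ?thesis
    using finite_set_of_finite_funs[of V "UNIV :: 'k set" 0] assms finite_subset by auto
qed

lemma subspace_coord_space: "fun_vs.subspace (coord_space V)"
  by (auto simp: fun_vs.subspace_def coord_space_def fun_scale_def)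

lemma subspace_lin_kernel: "fun_vs.subspace (lin_kernel V f a)"
proof -
  have "(\<Sum>i\<in>f. a i * (c * x i)) = c * (\<Sum>i\<in>f. a i * x i)" for c x
    by (simp add: sum_distrib_left algebra_simps)
  then show ?thesis
    using subspace_coord_space[of V]
    by (auto simp: fun_vs.subspace_def lin_kernel_def fun_scale_def distrib_left sum.distrib)
qed

section \<open>Inclusion-exclusion for tuples of points\<close>

lemma sum_Pow_alternating:
  assumes "finite S"
  shows "(\<Sum>B\<in>Pow S. (-1) ^ card B) = (if S = {} then 1 else 0 :: int)"
proof -
  \<comment> \<open>The sum over subsets is the expansion of a product whose factors are all 0, so
    it vanishes unless the product is empty.\<close>
  have "(\<Prod>x\<in>S. (-1) + 1 :: int) = (\<Sum>B\<in>Pow S. (\<Prod>x\<in>B. -1) * (\<Prod>x\<in>S - B. 1))"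
    by (rule prod_add[OF assms])
  then show ?thesis using assms by (auto simp: power_0_left)
qed

text \<open>For linear hyperplanes over a field with q elements, such \<open>m\<close>-tuples play
  the role of points over the extension of degree \<open>m\<close>: a hyperplane contains the point
  iff it contains every entry. This avoids constructing the extension field.\<close>

definition avoiding_tuples :: "nat \<Rightarrow> 'p set \<Rightarrow> 'p set set \<Rightarrow> (nat \<Rightarrow> 'p) set" where
  "avoiding_tuples m S A = {t \<in> {..<m} \<rightarrow>\<^sub>E S. \<forall>H\<in>A. \<exists>j<m. t j \<notin> H}"

text \<open>The power on the right counts the tuples with all entries in every member of
  \<open>B\<close>. After the sums are swapped, each tuple contributes the alternating sum over sets
  of those members of \<open>A\<close> that contain it entirely.\<close>

lemma card_avoiding_tuples:
  assumes "finite S" "finite A"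
  shows "int (card (avoiding_tuples m S A)) =
    (\<Sum>B\<in>Pow A. (-1) ^ card B * int (card (S \<inter> \<Inter>B)) ^ m)"
proof -
  let ?T = "{..<m} \<rightarrow>\<^sub>E S"
  let ?P = "\<lambda>t H. \<forall>j<m. t j \<in> H"
  have finT: "finite ?T" using assms(1) by (simp add: finite_PiE)
  have 1: "int (card (S \<inter> \<Inter>B)) ^ m = (\<Sum>t\<in>?T. if \<forall>H\<in>B. ?P t H then 1 else 0)" for B
  proof -
    have "{t \<in> ?T. \<forall>H\<in>B. ?P t H} = {..<m} \<rightarrow>\<^sub>E (S \<inter> \<Inter>B)"
      by (rule set_eqI) (auto simp: PiE_iff)
    then have "card {t \<in> ?T. \<forall>H\<in>B. ?P t H} = card (S \<inter> \<Inter>B) ^ m"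
      by (simp add: card_PiE)
    then show ?thesis
      using finT by (simp flip: sum.inter_filter of_nat_power)
  qed
  have 2: "(\<Sum>B\<in>Pow A. (-1) ^ card B * (if \<forall>H\<in>B. ?P t H then 1 else 0)) =
      (if \<forall>H\<in>A. \<exists>j<m. t j \<notin> H then 1 else 0 :: int)" for t
  proof -
    have "(\<Sum>B\<in>Pow A. (-1) ^ card B * (if \<forall>H\<in>B. ?P t H then 1 else 0)) =
        (\<Sum>B\<in>{B \<in> Pow A. \<forall>H\<in>B. ?P t H}. (-1) ^ card B :: int)"
      using assms(2) by (subst sum.inter_filter) (auto intro!: sum.cong)
    also have "{B \<in> Pow A. \<forall>H\<in>B. ?P t H} = Pow {H \<in> A. ?P t H}" by auto
    finally show ?thesis
      using assms(2) by (simp add: sum_Pow_alternating)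
  qed
  have "(\<Sum>B\<in>Pow A. (-1) ^ card B * int (card (S \<inter> \<Inter>B)) ^ m) =
      (\<Sum>t\<in>?T. \<Sum>B\<in>Pow A. (-1) ^ card B * (if \<forall>H\<in>B. ?P t H then 1 else 0))"
    unfolding 1 sum_distrib_left by (rule sum.swap)
  also have "\<dots> = int (card (avoiding_tuples m S A))"
    unfolding 2 avoiding_tuples_def using finT by (simp flip: sum.inter_filter)
  finally show ?thesis by simp
qed

text \<open>At q ^ m the monomial of an intersection W becomes (q ^ dim W) ^ m, which is the
  \<open>m\<close>-th power of the size of W.\<close>

lemma poly_arr_char_poly:
  fixes A :: "('v \<Rightarrow> 'k::{field,finite}) set set"
  assumes "finite V" "finite A" "\<And>H. H \<in> A \<Longrightarrow> fun_vs.subspace H"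
  shows "poly (arr_char_poly V A) (int (CARD('k) ^ m)) =
    int (card (avoiding_tuples m (coord_space V) A))"
proof -
  have "int (CARD('k) ^ m) ^ fun_dim (coord_space V \<inter> \<Inter>B) =
      int (card (coord_space V \<inter> \<Inter>B)) ^ m" if "B \<subseteq> A" for B
  proof -
    have "fun_vs.subspace (coord_space V \<inter> \<Inter>B)"
      using that assms(3) subspace_coord_space
      by (intro fun_vs.subspace_inter fun_vs.subspace_Inter) auto
    then have "card (coord_space V \<inter> \<Inter>B) = CARD('k) ^ fun_dim (coord_space V \<inter> \<Inter>B)"
      using finite_coord_space[OF assms(1)] by (intro card_subspace) auto
    then show ?thesis
      by (simp flip: power_mult add: mult.commute)
  qed
  then show ?thesis
    using assms(1,2)
    by (auto simp: arr_char_poly_def poly_sum poly_monom card_avoiding_tuples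
        finite_coord_space intro!: sum.cong)
qed

text \<open>The field is fixed, so varying \<open>m\<close> has to supply the infinitely many
  evaluation points; the powers of \<open>q\<close> are distinct because
  \<open>q > 1\<close>.\<close>

lemma poly_eqI_powers:
  fixes p r :: "int poly"
  assumes "q > 1" "\<And>m. poly p (int (q ^ m)) = poly r (int (q ^ m))"
  shows "p = r"
proof (rule ccontr)
  assume "p \<noteq> r"
  then have "finite {x. poly (p - r) x = 0}" by (intro poly_roots_finite) simp
  moreover have "range (\<lambda>m. int (q ^ m)) \<subseteq> {x. poly (p - r) x = 0}"
    using assms(2) by auto
  moreover have "inj (\<lambda>m. int (q ^ m))"
    using assms(1) by (auto intro!: injI simp: power_inject_exp simp del: of_nat_power)
  ultimately show False
    using finite_subset range_inj_infinite by blast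
qed

section \<open>Tuples avoiding the arrangement of a complex\<close>

text \<open>The condition does not mention the vertex set, so tuples over \<open>V\<close> and over
  \<open>V - {i2}\<close> can be compared face by face.\<close>

definition avoids_face :: "nat \<Rightarrow> (nat \<Rightarrow> 'v \<Rightarrow> 'k::field) \<Rightarrow> 'v set \<Rightarrow> bool" where
  "avoids_face m t f \<longleftrightarrow>
     (\<forall>a. (\<forall>i\<in>f. a i \<noteq> 0) \<longrightarrow> (\<exists>j<m. (\<Sum>i\<in>f. a i * t j i) \<noteq> 0))"

definition complex_tuples ::
    "nat \<Rightarrow> 'v set \<Rightarrow> 'v set set \<Rightarrow> (nat \<Rightarrow> 'v \<Rightarrow> 'k::field) set" where
  "complex_tuples m V F = avoiding_tuples m (coord_space V) (complex_arrangement V F)"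

lemma complex_tuples_eq:
  "complex_tuples m V F =
     {t \<in> {..<m} \<rightarrow>\<^sub>E coord_space V. \<forall>f\<in>F - {{}}. avoids_face m t f}"
proof -
  have "(\<forall>H\<in>complex_arrangement V F. \<exists>j<m. t j \<notin> H) \<longleftrightarrow> (\<forall>f\<in>F - {{}}. avoids_face m t f)"
    if t: "t \<in> {..<m} \<rightarrow>\<^sub>E coord_space V" for t :: "nat \<Rightarrow> 'a \<Rightarrow> 'b"
  proof -
    have "(\<exists>j<m. t j \<notin> lin_kernel V f a) \<longleftrightarrow> (\<exists>j<m. (\<Sum>i\<in>f. a i * t j i) \<noteq> 0)" for f a
      using t by (auto simp: lin_kernel_def PiE_iff)
    moreover have "(\<forall>H\<in>complex_arrangement V F. \<exists>j<m. t j \<notin> H) \<longleftrightarrow>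
        (\<forall>f\<in>F - {{}}. \<forall>a. (\<forall>i\<in>f. a i \<noteq> 0) \<longrightarrow> (\<exists>j<m. t j \<notin> lin_kernel V f a))"
      unfolding complex_arrangement_def by blast
    ultimately show ?thesis by (simp add: avoids_face_def)
  qed
  then show ?thesis
    unfolding complex_tuples_def avoiding_tuples_def by (intro Collect_cong conj_cong) auto
qed

lemma poly_complex_char_poly:
  assumes "finite V"
  shows "poly (complex_char_poly TYPE('k::{field,finite}) V F) (int (CARD('k) ^ m)) =
    int (card (complex_tuples m V F :: (nat \<Rightarrow> 'v \<Rightarrow> 'k) set))"
proof -
  have "complex_arrangement V F \<subseteq> Pow (coord_space V :: ('v \<Rightarrow> 'k) set)"
    by (auto simp: complex_arrangement_def lin_kernel_def)
  then have "finite (complex_arrangement V F :: ('v \<Rightarrow> 'k) set set)"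
    using finite_coord_space[OF assms] finite_subset by blast
  then show ?thesis
    unfolding complex_char_poly_def complex_tuples_def
    by (rule poly_arr_char_poly[OF assms])
      (auto simp: complex_arrangement_def subspace_lin_kernel)
qed

lemma finite_complex_tuples:
  assumes "finite V"
  shows "finite (complex_tuples m V F :: (nat \<Rightarrow> 'v \<Rightarrow> 'k::{field,finite}) set)"
  unfolding complex_tuples_def avoiding_tuples_def
  by (rule finite_subset[OF Collect_restrict]) (simp add: finite_PiE finite_coord_space assms)

section \<open>Avoiding the hyperplanes of a single face\<close>

lemma avoids_face_singleton:
  "avoids_face m t {i} \<longleftrightarrow> (\<exists>j<m. t j i \<noteq> 0)"
proof
  assume "avoids_face m t {i}"
  then show "\<exists>j<m. t j i \<noteq> 0"
    unfolding avoids_face_def by (elim allE[of _ "\<lambda>_. 1"]) simp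
qed (auto simp: avoids_face_def)

text \<open>All coefficient vectors without zeros on the face are quantified over. Relabelling the
  coordinates injectively and rescaling them by nonzero weights only permutes this family.\<close>

lemma avoids_face_image:
  fixes t :: "nat \<Rightarrow> 'v \<Rightarrow> 'k::field" and s :: "nat \<Rightarrow> 'w \<Rightarrow> 'k"
  assumes inj: "inj_on p f"
    and w: "\<And>i. i \<in> f \<Longrightarrow> w i \<noteq> 0"
    and ts: "\<And>i j. i \<in> f \<Longrightarrow> j < m \<Longrightarrow> t j i = w i * s j (p i)"
  shows "avoids_face m s (p ` f) \<longleftrightarrow> avoids_face m t f"
proof
  assume *: "avoids_face m s (p ` f)"
  show "avoids_face m t f"
    unfolding avoids_face_def
  proof (intro allI impI)
    fix a :: "'v \<Rightarrow> 'k" assume a: "\<forall>i\<in>f. a i \<noteq> 0"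
    define b where "b k = a (inv_into f p k) * w (inv_into f p k)" for k
    have b: "b (p i) = a i * w i" if "i \<in> f" for i
      using that inj by (simp add: b_def)
    have "(\<Sum>k\<in>p ` f. b k * s j k) = (\<Sum>i\<in>f. a i * t j i)" if "j < m" for j
      using inj that by (simp add: sum.reindex b ts mult.assoc)
    moreover have "\<forall>k\<in>p ` f. b k \<noteq> 0" using a w by (simp add: b)
    ultimately show "\<exists>j<m. (\<Sum>i\<in>f. a i * t j i) \<noteq> 0"
      using * unfolding avoids_face_def by metis
  qed
next
  assume *: "avoids_face m t f"
  show "avoids_face m s (p ` f)"
    unfolding avoids_face_def
  proof (intro allI impI)
    fix a :: "'w \<Rightarrow> 'k" assume a: "\<forall>k\<in>p ` f. a k \<noteq> 0"
    define b where "b i = a (p i) / w i" for i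
    have "(\<Sum>k\<in>p ` f. a k * s j k) = (\<Sum>i\<in>f. b i * t j i)" if "j < m" for j
      using inj that w by (simp add: sum.reindex b_def ts)
    moreover have "\<forall>i\<in>f. b i \<noteq> 0" using a w by (simp add: b_def)
    ultimately show "\<exists>j<m. (\<Sum>k\<in>p ` f. a k * s j k) \<noteq> 0"
      using * unfolding avoids_face_def by metis
  qed
qed

section \<open>Deletion and contraction of a maximal edge\<close>

locale maximal_edge =
  fixes V :: "'v set" and F :: "'v set set" and i1 i2 :: 'v
  assumes finite_V: "finite V"
    and complex: "simplicial_complex V F"
    and neq: "i1 \<noteq> i2"
    and maximal: "maximal_face F {i1, i2}"
begin

section \<open>Faces under deletion and contraction\<close>

lemma edge_in: "{i1, i2} \<in> F"
  using maximal by (simp add: maximal_face_def)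

lemma ends_in: "i1 \<in> V" "i2 \<in> V"
  using edge_in complex by (auto simp: simplicial_complex_def)

lemma singleton_in: "{i1} \<in> F - {{i1, i2}}"
  using complex ends_in neq by (auto simp: simplicial_complex_def)

lemma inj_on_identify:
  assumes "f \<in> F - {{i1, i2}}"
  shows "inj_on (identify i1 i2) f"
proof -
  have "\<not> {i1, i2} \<subseteq> f" using assms maximal by (auto simp: maximal_face_def)
  then show ?thesis by (auto simp: inj_on_def identify_def)
qed

text \<open>The edge collapses to \<open>{i1}\<close>, already the image of the face
  \<open>{i1}\<close>. Dropping the edge leaves only faces on which the identification is
  injective.\<close>

lemma contract_faces_eq:
  "contract_faces i1 i2 F = (\<lambda>f. identify i1 i2 ` f) ` (F - {{i1, i2}})"
proof -
  have "identify i1 i2 ` {i1, i2} = identify i1 i2 ` {i1}"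
    by (auto simp: identify_def)
  then show ?thesis
    using singleton_in unfolding contract_faces_def
    by (metis (no_types, lifting) edge_in image_insert insert_Diff insert_absorb)
qed

lemma identify_image: "identify i1 i2 ` V = V - {i2}"
  using ends_in neq by (auto simp: identify_def)

abbreviation "deleted \<equiv> delete_face F {i1, i2}"

section \<open>Tuples with proportional coordinates on the edge\<close>

definition proportional_tuples :: "nat \<Rightarrow> 'k::field \<Rightarrow> (nat \<Rightarrow> 'v \<Rightarrow> 'k) set" where
  "proportional_tuples m c = {t \<in> complex_tuples m V deleted. \<forall>j<m. t j i2 = c * t j i1}"

lemma tuple_nonzero:
  assumes "t \<in> complex_tuples m V deleted"
  obtains j where "j < m" "t j i1 \<noteq> 0"
proof -
  have "avoids_face m t {i1}"
    using assms singleton_in by (auto simp: complex_tuples_eq delete_face_def)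
  then show ?thesis using that by (auto simp: avoids_face_singleton)
qed

lemma complex_tuples_delete:
  "complex_tuples m V deleted =
     complex_tuples m V F \<union> (\<Union>c\<in>- {0}. proportional_tuples m c)"
proof (intro equalityI subsetI)
  fix t :: "nat \<Rightarrow> 'v \<Rightarrow> 'k::field"
  assume t: "t \<in> complex_tuples m V deleted"
  show "t \<in> complex_tuples m V F \<union> (\<Union>c\<in>- {0}. proportional_tuples m c)"
  proof (cases "avoids_face m t {i1, i2}")
    case True
    then show ?thesis using t by (auto simp: complex_tuples_eq delete_face_def)
  next
    case False
    then obtain a where a: "a i1 \<noteq> 0" "a i2 \<noteq> 0"
      and z: "\<And>j. j < m \<Longrightarrow> a i1 * t j i1 + a i2 * t j i2 = 0"
      using neq by (auto simp: avoids_face_def)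
    \<comment> \<open>The coefficients \<open>a\<close> do not depend on \<open>j\<close>, so one
      ratio serves all entries; it is nonzero because both coefficients are.\<close>
    have "t j i2 = - (a i1 / a i2) * t j i1" if "j < m" for j
      using z[OF that] a by (simp add: field_simps add_eq_0_iff)
    then have "t \<in> proportional_tuples m (- (a i1 / a i2))"
      using t by (simp add: proportional_tuples_def)
    then show ?thesis using a by auto
  qed
next
  fix t :: "nat \<Rightarrow> 'v \<Rightarrow> 'k::field"
  assume "t \<in> complex_tuples m V F \<union> (\<Union>c\<in>- {0}. proportional_tuples m c)"
  then show "t \<in> complex_tuples m V deleted"
    by (auto simp: proportional_tuples_def complex_tuples_eq delete_face_def)
qed

lemma complex_tuples_Int_proportional:
  assumes "c \<noteq> 0"
  shows "complex_tuples m V F \<inter> proportional_tuples m c = {}"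
proof -
  have "\<not> avoids_face m t {i1, i2}" if "t \<in> proportional_tuples m c" for t
  proof -
    \<comment> \<open>These coefficients give the form c x_i1 - x_i2, which vanishes on every entry
      of the tuple.\<close>
    define a where "a i = (if i = i1 then c else - 1)" for i
    have "(\<Sum>i\<in>{i1, i2}. a i * t j i) = 0" if "j < m" for j
      using that \<open>t \<in> _\<close> neq by (simp add: proportional_tuples_def a_def)
    moreover have "\<forall>i\<in>{i1, i2}. a i \<noteq> 0"
      using assms by (simp add: a_def)
    ultimately show ?thesis unfolding avoids_face_def by metis
  qed
  then show ?thesis
    using edge_in by (auto simp: complex_tuples_eq)
qed

lemma proportional_tuples_disjoint:
  assumes "c \<noteq> d"
  shows "proportional_tuples m c \<inter> proportional_tuples m d = {}"
proof (rule ccontr)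
  assume "\<not> ?thesis"
  then obtain t where t: "t \<in> proportional_tuples m c" "t \<in> proportional_tuples m d"
    by blast
  then have "t \<in> complex_tuples m V deleted"
    by (simp add: proportional_tuples_def)
  then obtain j where "j < m" "t j i1 \<noteq> 0"
    by (rule tuple_nonzero)
  moreover have "c * t j i1 = d * t j i1"
    using t \<open>j < m\<close> by (simp add: proportional_tuples_def)
  ultimately show False using assms by simp
qed

text \<open>This is \<open>avoids_face_image\<close> for the identification map, with weight
  \<open>c\<close> at \<open>i2\<close> and 1 elsewhere.\<close>

lemma avoids_contract_iff:
  fixes t s :: "nat \<Rightarrow> 'v \<Rightarrow> 'k::field"
  assumes "c \<noteq> 0"
    and "\<And>j. j < m \<Longrightarrow> t j = (s j)(i2 := c * s j i1)"
  shows "(\<forall>f\<in>contract_faces i1 i2 F - {{}}. avoids_face m s f) \<longleftrightarrow>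
    (\<forall>f\<in>deleted - {{}}. avoids_face m t f)"
proof -
  have "avoids_face m s (identify i1 i2 ` f) \<longleftrightarrow> avoids_face m t f" if "f \<in> F - {{i1, i2}}" for f
    using assms inj_on_identify[OF that]
    by (intro avoids_face_image[where w = "\<lambda>i. if i = i2 then c else 1"])
      (auto simp: identify_def)
  then show ?thesis
    unfolding contract_faces_eq delete_face_def by auto
qed

text \<open>The coordinate at \<open>i2\<close> is determined by the one at \<open>i1\<close>, so it
  can be erased and later restored without loss.\<close>

lemma card_proportional_tuples:
  fixes c :: "'k::field"
  assumes "c \<noteq> 0"
  shows "card (proportional_tuples m c) =
    card (complex_tuples m (V - {i2}) (contract_faces i1 i2 F) :: (nat \<Rightarrow> 'v \<Rightarrow> 'k) set)"
proof (rule bij_betw_same_card)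
  \<comment> \<open>Erasing means setting to 0, since points of
    \<open>coord_space (V - {i2})\<close> vanish at \<open>i2\<close>. Restriction to
    \<open>{..<m}\<close> keeps the tuples extensional.\<close>
  let ?r = "\<lambda>t. \<lambda>j\<in>{..<m}. (t j)(i2 := 0)"
  let ?e = "\<lambda>s. \<lambda>j\<in>{..<m}. (s j)(i2 := c * s j i1)"
  let ?N = "proportional_tuples m c"
  let ?G = "complex_tuples m (V - {i2}) (contract_faces i1 i2 F) :: (nat \<Rightarrow> 'v \<Rightarrow> 'k) set"
  show "bij_betw ?r ?N ?G"
  proof (rule bij_betw_byWitness[where f' = ?e])
    show "\<forall>t\<in>?N. ?e (?r t) = t"
    proof
      fix t assume t: "t \<in> ?N"
      then have "t \<in> extensional {..<m}"
        by (auto simp: proportional_tuples_def complex_tuples_eq PiE_iff)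
      then show "?e (?r t) = t"
        using t neq
        by (intro extensionalityI[of _ "{..<m}"])
          (auto simp: proportional_tuples_def fun_eq_iff)
    qed
    show "\<forall>s\<in>?G. ?r (?e s) = s"
    proof
      fix s assume s: "s \<in> ?G"
      then have "s \<in> extensional {..<m}" "\<And>j. j < m \<Longrightarrow> s j i2 = 0"
        by (auto simp: complex_tuples_eq PiE_iff coord_space_def)
      then show "?r (?e s) = s"
        by (intro extensionalityI[of _ "{..<m}"]) (auto simp: fun_eq_iff)
    qed
    show "?r ` ?N \<subseteq> ?G"
    proof (rule image_subsetI)
      fix t assume t: "t \<in> ?N"
      then have "(\<forall>f\<in>contract_faces i1 i2 F - {{}}. avoids_face m (?r t) f) \<longleftrightarrow>
          (\<forall>f\<in>deleted - {{}}. avoids_face m t f)"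
        using neq by (intro avoids_contract_iff[OF assms]) (auto simp: proportional_tuples_def)
      then show "?r t \<in> ?G"
        using t by (auto simp: proportional_tuples_def complex_tuples_eq coord_space_def PiE_iff)
    qed
    show "?e ` ?G \<subseteq> ?N"
    proof (rule image_subsetI)
      fix s assume s: "s \<in> ?G"
      have "(\<forall>f\<in>contract_faces i1 i2 F - {{}}. avoids_face m s f) \<longleftrightarrow>
          (\<forall>f\<in>deleted - {{}}. avoids_face m (?e s) f)"
        by (intro avoids_contract_iff[OF assms]) auto
      then show "?e s \<in> ?N"
        using s ends_in neq
        by (auto simp: proportional_tuples_def complex_tuples_eq coord_space_def PiE_iff)
    qed
  qed
qed

text \<open>The union in \<open>complex_tuples_delete\<close> is disjoint, and each of the nonzero
  ratios \<open>c\<close> contributes the same number of tuples.\<close>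

lemma card_complex_tuples_delete:
  "card (complex_tuples m V deleted :: (nat \<Rightarrow> 'v \<Rightarrow> 'k::{field,finite}) set) =
    card (complex_tuples m V F :: (nat \<Rightarrow> 'v \<Rightarrow> 'k) set) + (CARD('k) - 1) *
      card (complex_tuples m (V - {i2}) (contract_faces i1 i2 F) :: (nat \<Rightarrow> 'v \<Rightarrow> 'k) set)"
proof -
  let ?N = "proportional_tuples m :: 'k \<Rightarrow> _"
  have fin: "finite (?N c)" for c
    unfolding proportional_tuples_def
    by (rule finite_subset[OF Collect_restrict finite_complex_tuples[OF finite_V]])
  have "card (\<Union>c\<in>- {0}. ?N c) = (\<Sum>c\<in>- {0}. card (?N c))"
    by (intro card_UN_disjoint) (simp_all add: fin proportional_tuples_disjoint)
  also have "\<dots> = (CARD('k) - 1) *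
      card (complex_tuples m (V - {i2}) (contract_faces i1 i2 F) :: (nat \<Rightarrow> 'v \<Rightarrow> 'k) set)"
    by (simp add: card_proportional_tuples Compl_eq_Diff_UNIV card_Diff_subset)
  finally have "card (\<Union>c\<in>- {0}. ?N c) = (CARD('k) - 1) *
      card (complex_tuples m (V - {i2}) (contract_faces i1 i2 F) :: (nat \<Rightarrow> 'v \<Rightarrow> 'k) set)" .
  moreover have "complex_tuples m V F \<inter> (\<Union>c\<in>- {0}. ?N c) = {}"
    by (simp add: Int_UN_distrib complex_tuples_Int_proportional)
  ultimately show ?thesis
    unfolding complex_tuples_delete
    by (simp add: card_Un_disjoint fin finite_complex_tuples finite_V)
qed

section \<open>From counts to characteristic polynomials\<close>

theorem complex_char_poly_deletion_contraction:
  "complex_char_poly TYPE('k::{field,finite}) V F =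
     complex_char_poly TYPE('k) V deleted
     - smult (int (CARD('k)) - 1)
         (complex_char_poly TYPE('k) (identify i1 i2 ` V) (contract_faces i1 i2 F))"
proof (rule poly_eqI_powers)
  \<comment> \<open>The bound makes the powers of the field order distinct, and lets the
    natural-number difference \<open>CARD('k) - 1\<close> pass to the integers.\<close>
  have "card {0, 1 :: 'k} \<le> CARD('k)" by (rule card_mono) auto
  then show gt: "CARD('k) > 1" by simp
  show "poly (complex_char_poly TYPE('k) V F) (int (CARD('k) ^ m)) =
      poly (complex_char_poly TYPE('k) V deleted
        - smult (int (CARD('k)) - 1)
            (complex_char_poly TYPE('k) (identify i1 i2 ` V) (contract_faces i1 i2 F)))
        (int (CARD('k) ^ m))" for m
    using card_complex_tuples_delete[where 'k = 'k, of m] gt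
    by (simp add: poly_complex_char_poly finite_V identify_image of_nat_diff
        del: of_nat_power)
qed

end

theorem mainTheorem2:
  fixes q l i1 i2 :: nat and F :: "nat set set" and e :: "nat set"
  assumes "primepow q"
    and "CARD('k::{field,finite}) = q"
    and "simplicial_complex {1..l} F"
    and "e = {i1, i2}"
    and "e \<in> underlying_edges F"
    and "maximal_face F e"
  shows "complex_char_poly TYPE('k) {1..l} F =
           complex_char_poly TYPE('k) {1..l} (delete_face F e)
           - smult (int q - 1)
               (complex_char_poly TYPE('k) (identify i1 i2 ` {1..l}) (contract_faces i1 i2 F))"
proof -
  interpret maximal_edge "{1..l}" F i1 i2
  proof
    show "i1 \<noteq> i2" using assms(4,5) by (auto simp: underlying_edges_def)
  qed (use assms in auto)
  show ?thesis
    using complex_char_poly_deletion_contraction[where 'k = 'k] assms(2,4) by simp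
qed

end
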